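(* Let $(M,s)$ and $(M',s')$ be pointed models. If $(M,s)$ and $(M',s')$ are bisimilar, then for every $\varphi\in\mathcal{L}_{\mathsf{MISL}}$, $M,s\vDash_{\mathsf{MISL}}\varphi$ if and only if $M',s'\vDash_{\mathsf{MISL}}\varphi$.
   Context: $\mathcal{L}_{\mathsf{MISL}}$: $\varphi::=p\mid\neg\varphi\mid\varphi\land\varphi\mid\Diamond\varphi\mid\langle p:=\varphi\rangle\varphi\mid\langle(p:=\varphi)^*\rangle\varphi$, with $p$ from a countable set $\mathbf{P}$ of letters. A model is $M=(W,R,V)$ with $W\ne\emptyset$, $R\subseteq W\times W$, $V:\mathbf{P}\to2^W$; a pointed model is a model with a state. Truth: letters, Booleans and $\Diamond$ (along $R$) as usual; $M,w\vDash\langle p:=\psi\rangle\varphi$ iff $M|_{p:=\psi},w\vDash\varphi$, where $M|_{p:=\psi}$ is $M$ with the value of $p$ changed to $\{v\in W:M,v\vDash\psi\}$; $M,w\vDash\langle(p:=\psi)^*\rangle\varphi$ iff $M|_{(p:=\psi)^n},w\vDash\varphi$ for some $n\in\mathbb{N}$, where $M|_{(p:=\psi)^0}=M$ and $M|_{(p:=\psi)^{n+1}}=(M|_{(p:=\psi)^n})|_{p:=\psi}$. Bisimulation is the standard one for modal logic: a nonempty $Z\subseteq W\times W'$ is a bisimulation between $M=(W,R,V)$ and $M'=(W',R',V')$ if whenever $sZs'$: (Atom) $s$ and $s'$ satisfy the same letters of $\mathbf{P}$; (Zig) if $Rst$ then there is $t'$ with $R's't'$ and $tZt'$; (Zag)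 if $R's't'$ then there is $t$ with $Rst$ and $tZt'$. $(M,s)$ and $(M',s')$ are bisimilar if some bisimulation between $M$ and $M'$ links $s$ and $s'$. *)

theory Defs
  imports "HOL-Library.Countable"
begin

datatype 'p fm =
    Atom 'p
  | Neg "'p fm"
  | Conj "'p fm" "'p fm"
  | Dia "'p fm"
  | Assign 'p "'p fm" "'p fm"      (* \<open>\<langle>p := \<psi>\<rangle>\<phi>\<close> *)
  | AssignStar 'p "'p fm" "'p fm"  (* \<open>\<langle>(p := \<psi>)*\<rangle>\<phi>\<close> *)

record ('w, 'p) model =
  worlds :: "'w set"
  acc :: "('w \<times> 'w) set"
  val :: "'p \<Rightarrow> 'w set"

definition is_model :: "('w, 'p) model \<Rightarrow> bool" where
  "is_model M \<longleftrightarrow> worlds M \<noteq> {} \<and> acc M \<subseteq> worlds M \<times> worlds M \<and> (\<forall>p. val M p \<subseteq> worlds M)"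

definition pointed_model :: "('w, 'p) model \<Rightarrow> 'w \<Rightarrow> bool" where
  "pointed_model M s \<longleftrightarrow> is_model M \<and> s \<in> worlds M"

(* Reassigns p to the set of states satisfying Q. Q depends on the model, since iterating the
   update re-evaluates the assigned formula in the current model. With Q = (\<lambda>N v. sat N v \<psi>) this
   is M|p:=\<psi>, and its n-fold iterate is M|(p:=\<psi>)^n. *)
definition assign :: "'p \<Rightarrow> (('w, 'p) model \<Rightarrow> 'w \<Rightarrow> bool) \<Rightarrow> ('w, 'p) model \<Rightarrow> ('w, 'p) model" where
  "assign p Q M = M\<lparr>val := (val M)(p := {v \<in> worlds M. Q M v})\<rparr>"

primrec sat :: "('w, 'p) model \<Rightarrow> 'w \<Rightarrow> 'p fm \<Rightarrow> bool" where
  "sat M w (Atom p) \<longleftrightarrow> w \<in> val M p"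
| "sat M w (Neg \<phi>) \<longleftrightarrow> \<not> sat M w \<phi>"
| "sat M w (Conj \<phi> \<psi>) \<longleftrightarrow> sat M w \<phi> \<and> sat M w \<psi>"
| "sat M w (Dia \<phi>) \<longleftrightarrow> (\<exists>v. (w, v) \<in> acc M \<and> sat M v \<phi>)"
| "sat M w (Assign p \<psi> \<phi>) \<longleftrightarrow> sat (assign p (\<lambda>N v. sat N v \<psi>) M) w \<phi>"
| "sat M w (AssignStar p \<psi> \<phi>) \<longleftrightarrow> (\<exists>n. sat ((assign p (\<lambda>N v. sat N v \<psi>) ^^ n) M) w \<phi>)"

definition bisimulation ::
    "('w, 'p) model \<Rightarrow> ('v, 'p) model \<Rightarrow> ('w \<times> 'v) set \<Rightarrow> bool" where
  "bisimulation M M' Z \<longleftrightarrow>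
     Z \<noteq> {} \<and> Z \<subseteq> worlds M \<times> worlds M' \<and>
     (\<forall>s s'. (s, s') \<in> Z \<longrightarrow>
        (\<forall>p. s \<in> val M p \<longleftrightarrow> s' \<in> val M' p) \<and>
        (\<forall>t. (s, t) \<in> acc M \<longrightarrow> (\<exists>t'. (s', t') \<in> acc M' \<and> (t, t') \<in> Z)) \<and>
        (\<forall>t'. (s', t') \<in> acc M' \<longrightarrow> (\<exists>t. (s, t) \<in> acc M \<and> (t, t') \<in> Z)))"

definition bisimilar ::
    "('w, 'p) model \<Rightarrow> 'w \<Rightarrow> ('v, 'p) model \<Rightarrow> 'v \<Rightarrow> bool" where
  "bisimilar M s M' s' \<longleftrightarrow> (\<exists>Z. bisimulation M M' Z \<and> (s, s') \<in> Z)"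

end

theory Submission
  imports Defs
begin

text \<open>
  The usual induction on formulas breaks down for a fixed pair of models, because an assignment
  changes the valuation. What saves it is that updates alter neither the worlds nor the
  accessibility relation, so that \<^emph>\<open>the same\<close> relation \<open>Z\<close> stays a candidate bisimulation after
  any number of updates. Invariance is therefore proved for a fixed \<open>Z\<close> and all pairs of models
  between which \<open>Z\<close> is a bisimulation (\<open>sat_invariant\<close>). For \<open>\<langle>p := \<psi>\<rangle>\<phi>\<close> the induction hypothesis for
  \<open>\<psi>\<close> gives \<open>p\<close> matching new extensions on \<open>Z\<close>-linked states, which is the only clause of
  bisimulation that the update affects (\<open>bisimulation_assign\<close>); the induction hypothesis for \<open>\<phi>\<close>
  then applies to the updated pair of models. An iterated assignment re-evaluates \<open>\<psi>\<close> in each updated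
  model, and as the hypothesis for \<open>\<psi>\<close> covers all of these, \<open>Z\<close> survives every stage
  (\<open>bisimulation_assign_funpow\<close>); the number of iterations that witnesses the star on one side thus
  witnesses it on the other.
\<close>

lemma bisimulation_assign:
  assumes "bisimulation M M' Z"
    and "\<And>t t'. (t, t') \<in> Z \<Longrightarrow> Q M t \<longleftrightarrow> Q' M' t'"
  shows "bisimulation (assign p Q M) (assign p Q' M') Z"
proof -
  let ?N = "assign p Q M" and ?N' = "assign p Q' M'"
  have frame: "worlds ?N = worlds M" "acc ?N = acc M" "worlds ?N' = worlds M'" "acc ?N' = acc M'"
    by (simp_all add: assign_def)
  have "t \<in> val ?N q \<longleftrightarrow> t' \<in> val ?N' q" if "(t, t') \<in> Z" for t t' q
  proof -
    have "t \<in> worlds M" "t' \<in> worlds M'" "t \<in> val M q \<longleftrightarrow> t' \<in> val M' q"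
      using assms(1) that unfolding bisimulation_def by blast+
    then show ?thesis using assms(2)[OF that] by (simp add: assign_def)
  qed
  then show ?thesis
    using assms(1) unfolding bisimulation_def frame by blast
qed

lemma bisimulation_assign_funpow:
  assumes "bisimulation M M' Z"
    and "\<And>N N' t t'. bisimulation N N' Z \<Longrightarrow> (t, t') \<in> Z \<Longrightarrow> Q N t \<longleftrightarrow> Q' N' t'"
  shows "bisimulation ((assign p Q ^^ n) M) ((assign p Q' ^^ n) M') Z"
proof (induction n)
  case 0
  show ?case using assms(1) by simp
next
  case (Suc n)
  then show ?case
    by (simp add: bisimulation_assign assms(2))
qed

text \<open>
  The models and states vary in the induction while \<open>Z\<close> does not: the hypotheses are needed at
  updated models, and for an assigned formula at all \<open>Z\<close>-linked states rather than the current ones.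
\<close>

lemma sat_invariant:
  fixes M :: "('w, 'p) model" and M' :: "('v, 'p) model"
  assumes "bisimulation M M' Z" and "(s, s') \<in> Z"
  shows "sat M s \<phi> \<longleftrightarrow> sat M' s' \<phi>"
  using assms
proof (induction \<phi> arbitrary: M M' s s')
  case (Atom p)
  then show ?case unfolding bisimulation_def by simp
next
  case (Neg \<phi>)
  then show ?case by simp
next
  case (Conj \<phi> \<psi>)
  then show ?case by simp
next
  case (Dia \<phi>)
  have "\<And>t. (s, t) \<in> acc M \<Longrightarrow> \<exists>t'. (s', t') \<in> acc M' \<and> (t, t') \<in> Z"
    and "\<And>t'. (s', t') \<in> acc M' \<Longrightarrow> \<exists>t. (s, t) \<in> acc M \<and> (t, t') \<in> Z"
    using Dia.prems unfolding bisimulation_def by blast+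
  moreover have "\<And>t t'. (t, t') \<in> Z \<Longrightarrow> sat M t \<phi> \<longleftrightarrow> sat M' t' \<phi>"
    by (rule Dia.IH[OF Dia.prems(1)])
  ultimately show ?case unfolding sat.simps by blast
next
  case (Assign p \<psi> \<phi>)
  have "bisimulation (assign p (\<lambda>N v. sat N v \<psi>) M) (assign p (\<lambda>N v. sat N v \<psi>) M') Z"
    using Assign.prems(1) by (rule bisimulation_assign) (rule Assign.IH(1)[OF Assign.prems(1)])
  then show ?case
    using Assign.IH(2) Assign.prems(2) by simp
next
  case (AssignStar p \<psi> \<phi>)
  have "bisimulation ((assign p (\<lambda>N v. sat N v \<psi>) ^^ n) M)
          ((assign p (\<lambda>N v. sat N v \<psi>) ^^ n) M') Z" for n
    using AssignStar.prems(1) by (rule bisimulation_assign_funpow) (rule AssignStar.IH(1))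
  then have "sat ((assign p (\<lambda>N v. sat N v \<psi>) ^^ n) M) s \<phi> \<longleftrightarrow>
      sat ((assign p (\<lambda>N v. sat N v \<psi>) ^^ n) M') s' \<phi>" for n
    using AssignStar.prems(2) by (rule AssignStar.IH(2))
  then show ?case by simp
qed

theorem theorem6p2:
  fixes M :: "('w, 'p::countable) model" and M' :: "('v, 'p) model"
    and s :: 'w and s' :: 'v
  assumes "pointed_model M s" and "pointed_model M' s'"
    and "bisimilar M s M' s'"
  shows "\<forall>\<phi> :: 'p fm. sat M s \<phi> \<longleftrightarrow> sat M' s' \<phi>"
proof -
  obtain Z where "bisimulation M M' Z" and "(s, s') \<in> Z"
    using assms(3) unfolding bisimilar_def by blast
  then show ?thesis using sat_invariant[of M M' Z s s'] by simp
qed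

end
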